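(* Let $\alpha,\beta,\gamma,\delta,\varepsilon\in\mathbb{R}$ with $\alpha>0$ and $8\alpha\gamma\geq3\beta^2$, and let $h\colon\mathbb{R}\to\mathbb{R}$ be the (convex) quartic $h(x):=\alpha x^4+\beta x^3+\gamma x^2+\delta x+\varepsilon$. Let $y\in\mathbb{R}$. Then $$h^*(y)=y\,x_y-h(x_y),$$ where $p:=(8\alpha\gamma-3\beta^2)/(16\alpha^2)\geq0$, $q:=(8\alpha^2(\delta-y)+\beta^3-4\alpha\beta\gamma)/(32\alpha^3)$, $\Delta:=(p/3)^3+(q/2)^2\geq0$, and $$x_y:=-\frac{\beta}{4\alpha}+\sqrt[3]{\frac{-q}{2}+\sqrt{\Delta}}+\sqrt[3]{\frac{-q}{2}-\sqrt{\Delta}}.$$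
   Context: $h^*$ denotes the Fenchel conjugate, $h^*(y)=\sup_{x\in\mathbb{R}}\,(xy-h(x))$. For real $t$, $\sqrt[3]{t}$ denotes the unique real cube root of $t$ (also for negative $t$). *)

theory Defs
  imports "HOL-Analysis.Analysis"
begin

text \<open>The supremum is taken in \<^typ>\<open>ereal\<close>, so that it is meaningful (possibly \<open>\<infinity>\<close>)
  for every \<open>h\<close>; on \<^typ>\<open>real\<close> an unbounded supremum would be unspecified.\<close>

definition fenchel_conjugate :: "(real \<Rightarrow> real) \<Rightarrow> real \<Rightarrow> ereal"
  where "fenchel_conjugate h y = (SUP x. ereal (x * y - h x))"

end

theory Submission
  imports Defs
begin

text \<open>
  The supremum of \<open>x * y - h x\<close> is attained exactly where \<open>h\<close> has slope \<open>y\<close>, because a convex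
  function lies above each of its tangents. For the quartic this is visible without
  calculus. The shift \<open>z = x + \<beta> / (4 * \<alpha>)\<close> removes the cubic term and turns \<open>h x - y * x\<close> into
  \<open>\<alpha> * (z^4 + 2 * p * z^2 + 4 * q * z)\<close> plus a constant, with slope \<open>4 * \<alpha> * (z^3 + p * z + q)\<close>
  in \<open>z\<close>. Its excess over a tangent factors as a square times a sum of squares and \<open>2 * p\<close>
  (\<open>depressed_quartic_above_tangent\<close>), so \<open>p \<ge> 0\<close> gives the tangent inequality everywhere.
  Tangents at all points yield convexity (\<open>convex_on_if_supporting_lines\<close>); the tangent of slope
  \<open>y\<close> yields the conjugate (\<open>fenchel_conjugate_at_subgradient\<close>). That \<open>x\<^sub>y\<close> is the
  point of slope \<open>y\<close> is Cardano's formula for \<open>z^3 + p * z + q = 0\<close> (\<open>cardano_root\<close>).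
\<close>

text \<open>With \<open>u\<close> and \<open>v\<close> the two cube roots, \<open>u^3 + v^3 = - q\<close>, and the choice of the discriminant
  makes \<open>u * v = - p / 3\<close>; now \<open>(u + v)^3 = u^3 + v^3 + 3 * u * v * (u + v)\<close>.\<close>

lemma cardano_root:
  fixes p q D z :: real
  assumes D: "D = (p / 3)^3 + (q / 2)^2" and "D \<ge> 0"
    and z: "z = root 3 (- q / 2 + sqrt D) + root 3 (- q / 2 - sqrt D)"
  shows "z^3 + p * z + q = 0"
proof -
  define u where "u = root 3 (- q / 2 + sqrt D)"
  define v where "v = root 3 (- q / 2 - sqrt D)"
  have z_eq: "z = u + v"
    by (simp only: z u_def v_def)
  have sum_cubes: "u^3 + v^3 = - q"
    by (simp add: u_def v_def odd_real_root_pow)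
  have "(- q / 2 + sqrt D) * (- q / 2 - sqrt D) = (q / 2)^2 - (sqrt D)^2"
    by (simp add: algebra_simps power2_eq_square)
  also have "\<dots> = (- (p / 3))^3"
    using \<open>D \<ge> 0\<close> by (simp add: D)
  finally have "u * v = root 3 ((- (p / 3))^3)"
    unfolding u_def v_def real_root_mult [symmetric] by (rule arg_cong)
  then have uv: "u * v = - (p / 3)"
    using odd_real_root_power_cancel [of 3 "- (p / 3)"] by simp
  have "z^3 = u^3 + v^3 + 3 * (u * v) * z"
    by (simp add: z_eq power3_eq_cube algebra_simps)
  then show ?thesis
    by (simp add: sum_cubes uv)
qed

lemma depressed_quartic_above_tangent:
  fixes p q z w :: real
  assumes "p \<ge> 0"
  shows "w^4 + 2 * p * w^2 + 4 * q * w + 4 * (w^3 + p * w + q) * (z - w)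
    \<le> z^4 + 2 * p * z^2 + 4 * q * z"
proof -
  have "z^4 + 2 * p * z^2 + 4 * q * z
      - (w^4 + 2 * p * w^2 + 4 * q * w + 4 * (w^3 + p * w + q) * (z - w))
    = (z - w)^2 * ((z + w)^2 + 2 * w^2 + 2 * p)"
    by (simp add: algebra_simps power2_eq_square power3_eq_cube power4_eq_xxxx)
  also have "\<dots> \<ge> 0"
    using assms by simp
  finally show ?thesis by simp
qed

lemma convex_on_if_supporting_lines:
  fixes f s :: "real \<Rightarrow> real"
  assumes "\<And>x w. f w + s w * (x - w) \<le> f x"
  shows "convex_on UNIV f"
proof (rule convex_onI)
  fix t a b :: real
  assume t: "0 < t" "t < 1"
  define w where "w = (1 - t) * a + t * b"
  \<comment> \<open>The average of the supporting line at \<open>w\<close> over the end points is \<open>f w\<close>.\<close>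
  have "f w = (1 - t) * (f w + s w * (a - w)) + t * (f w + s w * (b - w))"
    by (simp add: w_def algebra_simps)
  also have "\<dots> \<le> (1 - t) * f a + t * f b"
    using t assms by (intro add_mono mult_left_mono) auto
  finally show "f ((1 - t) *\<^sub>R a + t *\<^sub>R b) \<le> (1 - t) * f a + t * f b"
    by (simp add: w_def)
qed simp

text \<open>The equality case of the Fenchel--Young inequality.\<close>

lemma fenchel_conjugate_at_subgradient:
  assumes "\<And>x. f w + y * (x - w) \<le> f x"
  shows "fenchel_conjugate f y = ereal (y * w - f w)"
  unfolding fenchel_conjugate_def
proof (rule antisym)
  show "(SUP x. ereal (x * y - f x)) \<le> ereal (y * w - f w)"
  proof (rule SUP_least)
    fix x
    show "ereal (x * y - f x) \<le> ereal (y * w - f w)"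
      using assms [of x] by (simp add: algebra_simps)
  qed
  show "ereal (y * w - f w) \<le> (SUP x. ereal (x * y - f x))"
    by (rule SUP_upper2 [of w]) (simp_all add: mult.commute)
qed

theorem proposition4p2:
  fixes \<alpha> \<beta> \<gamma> \<delta> \<epsilon> y p q \<Delta> x\<^sub>y :: real and h :: "real \<Rightarrow> real"
  assumes "\<alpha> > 0"
    and "8 * \<alpha> * \<gamma> \<ge> 3 * \<beta>^2"
    and "h = (\<lambda>x. \<alpha> * x^4 + \<beta> * x^3 + \<gamma> * x^2 + \<delta> * x + \<epsilon>)"
    and "p = (8 * \<alpha> * \<gamma> - 3 * \<beta>^2) / (16 * \<alpha>^2)"
    and "q = (8 * \<alpha>^2 * (\<delta> - y) + \<beta>^3 - 4 * \<alpha> * \<beta> * \<gamma>) / (32 * \<alpha>^3)"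
    and "\<Delta> = (p / 3)^3 + (q / 2)^2"
    and "x\<^sub>y = - \<beta> / (4 * \<alpha>) + root 3 (- q / 2 + sqrt \<Delta>) + root 3 (- q / 2 - sqrt \<Delta>)"
  shows "convex_on UNIV h \<and> p \<ge> 0 \<and> \<Delta> \<ge> 0 \<and>
    fenchel_conjugate h y = ereal (y * x\<^sub>y - h x\<^sub>y)"
proof -
  define b where "b = \<beta> / (4 * \<alpha>)"
  define G where "G z = z^4 + 2 * p * z^2 + 4 * q * z" for z
  define C where "C z = z^3 + p * z + q" for z
  have "p \<ge> 0"
    using assms(2,4) by simp
  then have "\<Delta> \<ge> 0"
    by (simp add: assms(6))
  \<comment> \<open>Expressing the coefficients through \<open>b\<close>, \<open>p\<close>, \<open>q\<close> makes the change of variable polynomial.\<close>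
  have \<beta>: "\<beta> = 4 * \<alpha> * b"
    using assms(1) by (simp add: b_def)
  have \<gamma>: "\<gamma> = \<alpha> * (2 * p + 6 * b^2)"
    using assms(1) by (simp add: assms(4) b_def field_simps power2_eq_square)
  have \<delta>: "\<delta> = y + 4 * \<alpha> * (q + p * b + b^3)"
    using assms(1)
    by (simp add: assms(4,5) b_def field_simps power2_eq_square power3_eq_cube)
  have depressed: "h x = \<alpha> * G (x + b) + y * x + (\<epsilon> - \<alpha> * G b)" for x
    by (simp add: assms(3) \<beta> \<gamma> \<delta> G_def algebra_simps power2_eq_square power3_eq_cube
        power4_eq_xxxx)
  have tangent: "h w + (4 * \<alpha> * C (w + b) + y) * (x - w) \<le> h x" for x w
  proof -
    have "G (w + b) + 4 * C (w + b) * (x - w) \<le> G (x + b)"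
      using depressed_quartic_above_tangent [OF \<open>p \<ge> 0\<close>, of "w + b" q "x + b"]
      by (simp add: G_def C_def)
    then have "\<alpha> * (G (w + b) + 4 * C (w + b) * (x - w)) \<le> \<alpha> * G (x + b)"
      using assms(1) by (intro mult_left_mono) auto
    then show ?thesis
      by (simp add: depressed algebra_simps)
  qed
  have "C (x\<^sub>y + b) = 0"
    unfolding C_def
    by (rule cardano_root [OF assms(6) \<open>\<Delta> \<ge> 0\<close>]) (simp add: assms(7) b_def)
  then have "h x\<^sub>y + y * (x - x\<^sub>y) \<le> h x" for x
    using tangent [of x\<^sub>y x] by simp
  then have "fenchel_conjugate h y = ereal (y * x\<^sub>y - h x\<^sub>y)"
    by (rule fenchel_conjugate_at_subgradient)
  moreover have "convex_on UNIV h"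
    by (rule convex_on_if_supporting_lines) (rule tangent)
  ultimately show ?thesis
    using \<open>p \<ge> 0\<close> \<open>\<Delta> \<ge> 0\<close> by simp
qed

end
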